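(* Strictly compact MWS codes are optimal among MWS codes: if $C$ is a strictly compact $[n,k]_q$ MWS code, then there exists no $[n',k]_q$ MWS code with $n'<n$.
   Context: $\mathbb{F}_q$ is the finite field with $q$ elements. An $[n,k]_q$ linear code is a $k$-dimensional subspace of $\mathbb{F}_q^n$; it is an $[n,k,d]_q$ code if its minimum distance (smallest nonzero Hamming weight of a codeword) is $d$. For a linear code $C$, $S(C)$ denotes the set of Hamming weights of nonzero codewords of $C$. With $q_k=\frac{q^k-1}{q-1}$, a $k$-dimensional linear code over $\mathbb{F}_q$ has at most $q_k$ distinct nonzero weights; it is called a maximum weight spectrum (MWS) code if $|S(C)|=q_k$. An $[n,k,d]_q$ MWS code $C$ is compact if $S(C)=\{d,d+1,\ldots,d+q_k-1\}$, and strictly compact if it is compact and $n\in S(C)$. An MWS code is called optimal if there exists no MWS code (over the same field) with equal dimension and strictly smaller length.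
   Formalization: The case k = 1 is excluded, where the claim fails: the repetition code of any length n ≥ 2 is a strictly compact [n,1] MWS code, but the [1,1] code is a shorter MWS code of the same dimension. *)

theory Defs
  imports "Jordan_Normal_Form.VS_Connect" "HOL-Library.Cardinality"
begin

text \<open>
  The field with \<open>q\<close> elements is a type \<open>'a :: {field, finite}\<close> with \<open>q = CARD('a)\<close>. The space of
  words of length \<open>n\<close> is \<open>module_vec TYPE('a) n\<close>, with carrier \<open>carrier_vec n\<close>, so that the
  length \<open>n\<close> is an ordinary natural number and codes of different lengths can be compared.
\<close>

definition hamming_weight :: "'a :: zero vec \<Rightarrow> nat" where
  "hamming_weight v = card {i. i < dim_vec v \<and> v $ i \<noteq> 0}"

definition linear_code :: "nat \<Rightarrow> nat \<Rightarrow> 'a :: {field, finite} vec set \<Rightarrow> bool" where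
  "linear_code n k C \<longleftrightarrow>
     VectorSpace.subspace class_ring C (module_vec TYPE('a) n) \<and>
     vectorspace.dim class_ring ((module_vec TYPE('a) n)\<lparr>carrier := C\<rparr>) = k"

definition weight_set :: "'a :: zero vec set \<Rightarrow> nat set" where
  "weight_set C = {hamming_weight c | c. c \<in> C \<and> c \<noteq> 0\<^sub>v (dim_vec c)}"

text \<open>Unspecified for a code without nonzero codewords.\<close>

definition min_distance :: "'a :: zero vec set \<Rightarrow> nat" where
  "min_distance C = Min (weight_set C)"

text \<open>The division is exact.\<close>

definition max_weights :: "nat \<Rightarrow> nat \<Rightarrow> nat" where
  "max_weights q k = (q ^ k - 1) div (q - 1)"

definition MWS_code :: "nat \<Rightarrow> nat \<Rightarrow> 'a :: {field, finite} vec set \<Rightarrow> bool" where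
  "MWS_code n k C \<longleftrightarrow> linear_code n k C \<and> card (weight_set C) = max_weights CARD('a) k"

text \<open>The half-open interval is \<open>{d, \<dots>, d + q\<^sub>k - 1}\<close> without truncated subtraction.\<close>

definition compact_MWS_code :: "nat \<Rightarrow> nat \<Rightarrow> 'a :: {field, finite} vec set \<Rightarrow> bool" where
  "compact_MWS_code n k C \<longleftrightarrow> MWS_code n k C \<and>
     weight_set C = {min_distance C ..< min_distance C + max_weights CARD('a) k}"

definition strictly_compact_MWS_code :: "nat \<Rightarrow> nat \<Rightarrow> 'a :: {field, finite} vec set \<Rightarrow> bool" where
  "strictly_compact_MWS_code n k C \<longleftrightarrow> compact_MWS_code n k C \<and> n \<in> weight_set C"

definition optimal_MWS_code :: "nat \<Rightarrow> nat \<Rightarrow> 'a :: {field, finite} vec set \<Rightarrow> bool" where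
  "optimal_MWS_code n k C \<longleftrightarrow> MWS_code n k C \<and>
     \<not> (\<exists>n' (C' :: 'a vec set). n' < n \<and> MWS_code n' k C')"

text \<open>
  Strict compactness implies optimality only for \<open>k \<noteq> 1\<close>: the repetition code of any length \<open>n > 0\<close>
  is a strictly compact MWS code of dimension 1, and the one of length 1 is shorter than all others.
\<close>

end

theory Submission
  imports Defs
begin

text \<open>
  Write \<open>q\<close> for the size of the field and \<open>q\<^sub>k = 1 + q + \<dots> + q\<^bsup>k-1\<^esup>\<close>. Proportional words have
  equal weight, and a code of dimension \<open>k\<close> has exactly \<open>q\<^sub>k\<close> lines through the origin. So in an MWS
  code every weight belongs to exactly one line, that is, to \<open>q - 1\<close> words, and the total weight of
  the code is \<open>q - 1\<close> times the sum of its weight set \<open>S\<close>.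

  The total weight can also be counted by coordinates. If \<open>m\<close> is the number of coordinates in which
  some codeword is nonzero, then each of them is nonzero in exactly \<open>q\<^sup>k - q\<^bsup>k-1\<^esup>\<close> codewords.
  Comparing the two counts, \<open>S\<close> has sum \<open>m q\<^bsup>k-1\<^esup>\<close>. Since \<open>S\<close> has \<open>q\<^sub>k = q\<^bsup>k-1\<^esup> + q\<^bsub>k-1\<^esub>\<close>
  elements, the deficits \<open>m - w\<close> of the weights \<open>w \<in> S\<close> have sum \<open>m q\<^bsub>k-1\<^esub>\<close>
  (lemma \<open>MWS_code_sum_deficits\<close>).

  The deficits are \<open>q\<^sub>k\<close> distinct natural numbers, so their sum is at least
  \<open>0 + 1 + \<dots> + (q\<^sub>k - 1)\<close>. For every MWS code this bounds \<open>m q\<^bsub>k-1\<^esub>\<close>, and hence the length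
  times \<open>q\<^bsub>k-1\<^esub>\<close>, from below (lemma \<open>MWS_code_length_bound\<close>). In a strictly compact code some
  word has weight \<open>n\<close>, so that \<open>m = n\<close>, and the weights are the \<open>q\<^sub>k\<close> largest numbers up to \<open>n\<close>; the
  deficits are then exactly \<open>0, 1, \<dots>, q\<^sub>k - 1\<close>, and the bound is attained
  (lemma \<open>strictly_compact_MWS_code_length\<close>). For \<open>k \<ge> 2\<close> the factor \<open>q\<^bsub>k-1\<^esub>\<close> is positive and can
  be cancelled. For \<open>k = 1\<close> it is zero and the bound says nothing about the length.
\<close>

section \<open>The number of words of a linear code\<close>

text \<open>
  Coordinates with respect to a basis \<open>B\<close> identify the space with the functions from \<open>B\<close> to the
  field.
\<close>

lemma (in vectorspace) card_carrier_eq_power_dim: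
  assumes "finite (carrier V)"
  shows "card (carrier V) = card (carrier K) ^ dim"
proof -
  have "span (carrier V) = carrier V"
    using in_own_span[of "carrier V"] span_is_subset2[of "carrier V"] by auto
  then have fin_dim
    using assms unfolding fin_dim_def by blast
  then obtain B where B: "finite B" "basis B"
    using finite_basis_exists by blast
  then have sub: "B \<subseteq> carrier V"
    by (simp add: basis_def)
  have "\<exists>!a. a \<in> B \<rightarrow>\<^sub>E carrier K \<and> lincomb a B = v" if "v \<in> carrier V" for v
    using basis_criterion[OF B(1) sub] B(2) that by blast
  moreover have "lincomb a B \<in> carrier V" if "a \<in> B \<rightarrow>\<^sub>E carrier K" for a
    using that sub by (intro lincomb_closed) auto
  ultimately have "bij_betw (\<lambda>a. lincomb a B) (B \<rightarrow>\<^sub>E carrier K) (carrier V)"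
    unfolding bij_betw_def inj_on_def by (auto simp: image_iff) metis+
  then have "card (carrier V) = card (B \<rightarrow>\<^sub>E carrier K)"
    by (simp add: bij_betw_same_card)
  also have "\<dots> = card (carrier K) ^ card B"
    by (simp add: card_PiE B(1))
  finally show ?thesis
    by (simp add: dim_basis[OF B])
qed

lemma finite_carrier_vec: "finite (carrier_vec n :: 'a :: finite vec set)"
proof (rule finite_surj)
  show "finite ({..<n} \<rightarrow>\<^sub>E (UNIV :: 'a set))"
    by (intro finite_PiE) auto
  show "carrier_vec n \<subseteq> (\<lambda>f. vec n f) ` ({..<n} \<rightarrow>\<^sub>E (UNIV :: 'a set))"
  proof
    fix v :: "'a vec"
    assume "v \<in> carrier_vec n"
    then have "v = vec n (restrict (($) v) {..<n})"
      by (intro eq_vecI) auto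
    then show "v \<in> (\<lambda>f. vec n f) ` ({..<n} \<rightarrow>\<^sub>E (UNIV :: 'a set))"
      by (intro image_eqI[where x = "restrict (($) v) {..<n}"]) auto
  qed
qed

text \<open>
  The counting arguments treat a code as a finite set of words of known size, closed under addition
  and scaling.
\<close>

lemma
  fixes C :: "'a :: {field, finite} vec set"
  assumes "linear_code n k C"
  shows linear_code_subset: "C \<subseteq> carrier_vec n"
    and linear_code_add: "\<And>v w. v \<in> C \<Longrightarrow> w \<in> C \<Longrightarrow> v + w \<in> C"
    and linear_code_zero: "0\<^sub>v n \<in> C"
    and linear_code_smult: "\<And>a v. v \<in> C \<Longrightarrow> a \<cdot>\<^sub>v v \<in> C"
    and linear_code_finite: "finite C"
    and card_linear_code: "card C = CARD('a) ^ k"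
proof -
  let ?V = "module_vec TYPE('a) n"
  have sub: "VectorSpace.subspace class_ring C ?V"
    and dim: "vectorspace.dim class_ring (?V\<lparr>carrier := C\<rparr>) = k"
    using assms unfolding linear_code_def by auto
  then interpret submodule class_ring C ?V
    by (simp add: VectorSpace.subspace_def)
  show C: "C \<subseteq> carrier_vec n"
    using subset by (simp add: module_vec_simps)
  show "v + w \<in> C" if "v \<in> C" "w \<in> C" for v w
    using m_closed[OF that] by (simp add: module_vec_simps)
  show "0\<^sub>v n \<in> C"
    using zero_closed by (simp add: module_vec_simps)
  show "a \<cdot>\<^sub>v v \<in> C" if "v \<in> C" for a v
    using smult_closed[of a v] that by (simp add: module_vec_simps class_ring_simps)
  show fin: "finite C"
    using C finite_carrier_vec finite_subset by blast
  have "vectorspace class_ring (?V\<lparr>carrier := C\<rparr>)"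
    using vectorspace.subspace_is_vs[OF vec_vs sub] .
  from vectorspace.card_carrier_eq_power_dim[OF this] fin dim
  show "card C = CARD('a) ^ k"
    by (simp add: class_ring_simps)
qed

section \<open>The total weight of a linear code\<close>

text \<open>
  The length of a code is an unsuitable measure for counting, because coordinates that vanish on the
  whole code contribute no weight. The size of the support takes its place.
\<close>

definition code_support :: "nat \<Rightarrow> 'a :: zero vec set \<Rightarrow> nat set" where
  "code_support n C = {i. i < n \<and> (\<exists>c\<in>C. c $ i \<noteq> 0)}"

lemma finite_code_support [simp]: "finite (code_support n C)"
  by (simp add: code_support_def)

lemma card_code_support_le: "card (code_support n C) \<le> n"
  using card_mono[of "{..<n}" "code_support n C"] by (auto simp: code_support_def)

lemma hamming_weight_eq_support:
  assumes "C \<subseteq> carrier_vec n" "c \<in> C"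
  shows "hamming_weight c = card {i \<in> code_support n C. c $ i \<noteq> 0}"
  unfolding hamming_weight_def code_support_def using assms
  by (intro arg_cong[where f = card]) auto

text \<open>
  If \<open>e\<close> is a codeword with \<open>e\<^sub>i = 1\<close>, then every codeword is, in a unique way, the sum of a multiple
  of \<open>e\<close> and a codeword that vanishes in \<open>i\<close>: the values in coordinate \<open>i\<close> are equidistributed.
\<close>

lemma card_codewords_zero_at:
  fixes C :: "'a :: {field, finite} vec set"
  assumes C: "linear_code n k C" and i: "i \<in> code_support n C"
  shows "CARD('a) * card {c \<in> C. c $ i = 0} = card C"
proof -
  from i obtain b where b: "b \<in> C" "b $ i \<noteq> 0" "i < n"
    by (auto simp: code_support_def)
  note sub = linear_code_subset[OF C]
  note closed = linear_code_add[OF C] linear_code_smult[OF C]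
  define e where "e = inverse (b $ i) \<cdot>\<^sub>v b"
  have dim: "dim_vec v = n" if "v \<in> C" for v
    using sub that by auto
  have e: "e \<in> C" "e $ i = 1"
    using b closed dim by (auto simp: e_def)
  let ?Z = "{c \<in> C. c $ i = 0}"
  have "bij_betw (\<lambda>(a, z). z + a \<cdot>\<^sub>v e) (UNIV \<times> ?Z) C"
  proof (rule bij_betw_byWitness[where f' = "\<lambda>c. (c $ i, c + (- (c $ i)) \<cdot>\<^sub>v e)"])
    show "\<forall>p\<in>UNIV \<times> ?Z. (\<lambda>c. (c $ i, c + (- (c $ i)) \<cdot>\<^sub>v e)) ((\<lambda>(a, z). z + a \<cdot>\<^sub>v e) p) = p"
      using e b(3) dim by (auto intro!: eq_vecI)
    show "\<forall>c\<in>C. (\<lambda>(a, z). z + a \<cdot>\<^sub>v e) (c $ i, c + (- (c $ i)) \<cdot>\<^sub>v e) = c"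
      using e dim by (auto intro!: eq_vecI)
    show "(\<lambda>(a, z). z + a \<cdot>\<^sub>v e) ` (UNIV \<times> ?Z) \<subseteq> C"
      using e closed by auto
    show "(\<lambda>c. (c $ i, c + (- (c $ i)) \<cdot>\<^sub>v e)) ` C \<subseteq> UNIV \<times> ?Z"
      using e b(3) closed dim by auto
  qed
  then have "card (UNIV \<times> ?Z :: ('a \<times> 'a vec) set) = card C"
    by (rule bij_betw_same_card)
  then show ?thesis
    by (simp add: card_cartesian_product)
qed

text \<open>
  Double counting of the nonzero entries, by words and by coordinates. A coordinate of the
  support is zero in one codeword out of \<open>q\<close>.
\<close>

lemma sum_hamming_weight:
  fixes C :: "'a :: {field, finite} vec set"
  assumes C: "linear_code n (Suc r) C"
  shows "(\<Sum>c\<in>C. hamming_weight c) = card (code_support n C) * ((CARD('a) - 1) * CARD('a) ^ r)"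
proof -
  let ?M = "code_support n C"
  note fin = linear_code_finite[OF C]
  have nonzero: "card {c \<in> C. c $ i \<noteq> 0} = (CARD('a) - 1) * CARD('a) ^ r" if "i \<in> ?M" for i
  proof -
    have "CARD('a) * card {c \<in> C. c $ i = 0} = CARD('a) * CARD('a) ^ r"
      using card_codewords_zero_at[OF C that] card_linear_code[OF C] by simp
    then have zero: "card {c \<in> C. c $ i = 0} = CARD('a) ^ r"
      by simp
    have "{c \<in> C. c $ i \<noteq> 0} = C - {c \<in> C. c $ i = 0}"
      by auto
    then have "card {c \<in> C. c $ i \<noteq> 0} = CARD('a) ^ Suc r - CARD('a) ^ r"
      using fin zero card_linear_code[OF C] by (simp add: card_Diff_subset)
    then show ?thesis
      by (simp add: diff_mult_distrib)
  qed
  have "(\<Sum>c\<in>C. hamming_weight c) = (\<Sum>c\<in>C. card {i \<in> ?M. c $ i \<noteq> 0})"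
    using hamming_weight_eq_support[OF linear_code_subset[OF C]] by simp
  also have "\<dots> = (\<Sum>i\<in>?M. card {c \<in> C. c $ i \<noteq> 0})"
    using fin by (intro sum_multicount_gen) auto
  finally show ?thesis
    using nonzero by simp
qed

section \<open>The weights of a maximum weight spectrum code\<close>

lemma max_weights_eq_sum:
  assumes "q \<ge> 2"
  shows "max_weights q k = (\<Sum>i<k. q ^ i)"
proof -
  have "(q - 1) * (\<Sum>i<k. q ^ i) + 1 = q ^ k"
  proof (induction k)
    case (Suc k)
    have "(q - 1) * (\<Sum>i<Suc k. q ^ i) + 1 = (q - 1) * q ^ k + q ^ k"
      using Suc by (simp add: add_mult_distrib2)
    also have "\<dots> = ((q - 1) + 1) * q ^ k"
      by (simp only: add_mult_distrib mult_1)
    finally show ?case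
      using assms by simp
  qed simp
  then have "q ^ k - 1 = (q - 1) * (\<Sum>i<k. q ^ i)"
    by simp
  then show ?thesis
    using assms by (simp add: max_weights_def)
qed

lemma max_weights_Suc: "q \<ge> 2 \<Longrightarrow> max_weights q (Suc k) = q ^ k + max_weights q k"
  by (simp add: max_weights_eq_sum)

lemma max_weights_mult:
  assumes "q \<ge> 2"
  shows "(q - 1) * max_weights q k = q ^ k - 1"
proof (induction k)
  case (Suc k)
  have "q ^ k \<ge> 1" "q ^ k \<le> q * q ^ k"
    using assms by auto
  then show ?case
    using Suc by (simp add: max_weights_Suc[OF assms] add_mult_distrib2 diff_mult_distrib)
qed (simp add: max_weights_def)

lemma card_field_ge_2: "CARD('a :: {field, finite}) \<ge> 2"
  using card_mono[of "UNIV :: 'a set" "{0, 1}"] by simp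

lemma hamming_weight_smult:
  fixes a :: "'a :: field"
  assumes "a \<noteq> 0"
  shows "hamming_weight (a \<cdot>\<^sub>v c) = hamming_weight c"
  unfolding hamming_weight_def using assms by (intro arg_cong[where f = card]) auto

lemma hamming_weight_zero: "hamming_weight (0\<^sub>v n) = 0"
  by (simp add: hamming_weight_def)

lemma weight_set_eq:
  assumes "C \<subseteq> carrier_vec n"
  shows "weight_set C = hamming_weight ` (C - {0\<^sub>v n})"
  using assms unfolding weight_set_def by fastforce

text \<open>
  A nonzero word of weight \<open>w\<close> has \<open>q - 1\<close> distinct nonzero multiples, all of weight \<open>w\<close>.
\<close>

lemma card_codewords_of_weight_ge:
  fixes C :: "'a :: {field, finite} vec set"
  assumes C: "linear_code n k C" and w: "w \<in> weight_set C"
  shows "CARD('a) - 1 \<le> card {c \<in> C - {0\<^sub>v n}. hamming_weight c = w}"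
proof -
  note sub = linear_code_subset[OF C]
  obtain c where c: "c \<in> C" "c \<noteq> 0\<^sub>v n" "w = hamming_weight c"
    using w weight_set_eq[OF sub] by auto
  have dim: "dim_vec c = n"
    using sub c(1) by auto
  obtain i where i: "i < n" "c $ i \<noteq> 0"
    using c(2) dim by (metis eq_vecI index_zero_vec)
  have inj: "inj_on (\<lambda>a. a \<cdot>\<^sub>v c) (UNIV - {0})"
  proof (rule inj_onI)
    fix a b
    assume "a \<cdot>\<^sub>v c = b \<cdot>\<^sub>v c"
    then have "(a \<cdot>\<^sub>v c) $ i = (b \<cdot>\<^sub>v c) $ i"
      by simp
    then show "a = b"
      using i dim by simp
  qed
  have "a \<cdot>\<^sub>v c \<noteq> 0\<^sub>v n" if "a \<noteq> 0" for a
  proof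
    assume "a \<cdot>\<^sub>v c = 0\<^sub>v n"
    then have "(a \<cdot>\<^sub>v c) $ i = 0"
      using i by simp
    then show False
      using that i dim by simp
  qed
  then have "(\<lambda>a. a \<cdot>\<^sub>v c) ` (UNIV - {0}) \<subseteq> {c \<in> C - {0\<^sub>v n}. hamming_weight c = w}"
    using c linear_code_smult[OF C] by (auto simp: hamming_weight_smult)
  then have "card (UNIV - {0 :: 'a}) \<le> card {c \<in> C - {0\<^sub>v n}. hamming_weight c = w}"
    using inj linear_code_finite[OF C] by (intro card_inj_on_le) auto
  then show ?thesis
    by (simp add: card_Diff_singleton)
qed

text \<open>
  Each of the \<open>q\<^sub>k\<close> weights occurs for at least \<open>q - 1\<close> words, and there are only
  \<open>q\<^sup>k - 1 = (q - 1) q\<^sub>k\<close> nonzero words. So each weight occurs exactly \<open>q - 1\<close> times.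
\<close>

lemma MWS_code_sum_hamming_weight:
  fixes C :: "'a :: {field, finite} vec set"
  assumes "MWS_code n k C"
  shows "(\<Sum>c\<in>C. hamming_weight c) = (CARD('a) - 1) * \<Sum>(weight_set C)"
proof -
  have C: "linear_code n k C" and card: "card (weight_set C) = max_weights CARD('a) k"
    using assms by (auto simp: MWS_code_def)
  note S = weight_set_eq[OF linear_code_subset[OF C]]
  let ?C = "C - {0\<^sub>v n}"
  let ?F = "\<lambda>w. {c \<in> ?C. hamming_weight c = w}"
  have fin: "finite ?C"
    using linear_code_finite[OF C] by simp
  have finS: "finite (weight_set C)"
    using fin S by simp
  have "(\<Sum>w\<in>weight_set C. card (?F w)) = (\<Sum>c\<in>?C. 1)"
    unfolding S sum.image_gen[OF fin, of "\<lambda>_. 1" hamming_weight] by simp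
  also have "\<dots> = CARD('a) ^ k - 1"
    using linear_code_finite[OF C] linear_code_zero[OF C] card_linear_code[OF C] by simp
  also have "\<dots> = (\<Sum>w\<in>weight_set C. CARD('a) - 1)"
    using max_weights_mult[of "CARD('a)" k] card_field_ge_2[where 'a = 'a]
    by (simp add: card mult.commute)
  finally have eq: "card (?F w) = CARD('a) - 1" if "w \<in> weight_set C" for w
    using sum_mono_inv[of "\<lambda>_. CARD('a) - 1" "weight_set C" "\<lambda>w. card (?F w)" w]
      card_codewords_of_weight_ge[OF C] that finS by simp
  have "(\<Sum>c\<in>C. hamming_weight c) = (\<Sum>c\<in>?C. hamming_weight c)"
    using linear_code_finite[OF C] by (intro sum.mono_neutral_right) (auto simp: hamming_weight_zero)
  also have "\<dots> = (\<Sum>w\<in>weight_set C. \<Sum>c\<in>?F w. hamming_weight c)"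
    unfolding S using fin by (rule sum.image_gen)
  also have "\<dots> = (\<Sum>w\<in>weight_set C. (CARD('a) - 1) * w)"
    using eq by (intro sum.cong) auto
  finally show ?thesis
    by (simp add: sum_distrib_left)
qed

lemma weight_set_le_support:
  assumes "C \<subseteq> carrier_vec n" "w \<in> weight_set C"
  shows "w \<le> card (code_support n C)"
proof -
  obtain c where "c \<in> C" "w = hamming_weight c"
    using assms by (auto simp: weight_set_def)
  then show ?thesis
    using hamming_weight_eq_support[OF assms(1)] by (auto intro!: card_mono)
qed

text \<open>
  The two counts of the total weight give the sum \<open>m q\<^sup>r\<close> for the weight set. It is subtracted from
  \<open>m\<close> times the number \<open>q\<^bsub>r+1\<^esub> = q\<^sup>r + q\<^sub>r\<close> of weights. Passing to deficits turns the upper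
  bound \<open>m\<close> on the weights into a sum of distinct natural numbers, which has an obvious minimum.
\<close>

lemma MWS_code_sum_deficits:
  fixes C :: "'a :: {field, finite} vec set"
  assumes MWS: "MWS_code n (Suc r) C"
  defines "m \<equiv> card (code_support n C)"
  shows "(\<Sum>w\<in>weight_set C. m - w) = m * max_weights CARD('a) r"
proof -
  have C: "linear_code n (Suc r) C"
    and card: "card (weight_set C) = max_weights CARD('a) (Suc r)"
    using MWS by (auto simp: MWS_code_def)
  note q = card_field_ge_2[where 'a = 'a]
  have "(CARD('a) - 1) * \<Sum>(weight_set C) = m * ((CARD('a) - 1) * CARD('a) ^ r)"
    using MWS_code_sum_hamming_weight[OF MWS] sum_hamming_weight[OF C] by (simp only: m_def)
  then have "(CARD('a) - 1) * \<Sum>(weight_set C) = (CARD('a) - 1) * (m * CARD('a) ^ r)"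
    by (simp only: mult.left_commute)
  moreover have "CARD('a) - 1 \<noteq> 0"
    using q by simp
  ultimately have sum: "\<Sum>(weight_set C) = m * CARD('a) ^ r"
    by (metis mult_cancel1)
  have "(\<Sum>w\<in>weight_set C. m - w) = (\<Sum>w\<in>weight_set C. m) - \<Sum>(weight_set C)"
    using weight_set_le_support[OF linear_code_subset[OF C]]
    by (intro sum_subtractf_nat) (auto simp: m_def)
  also have "\<dots> = m * (CARD('a) ^ r + max_weights CARD('a) r) - m * CARD('a) ^ r"
    by (simp add: card sum max_weights_Suc[OF q] mult.commute)
  finally show ?thesis
    by (simp add: add_mult_distrib2)
qed

text \<open>
  The deficits are distinct natural numbers, and no set of \<open>N\<close> natural numbers has a smaller sum
  than \<open>{0, \<dots>, N - 1}\<close>.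
\<close>

lemma MWS_code_length_bound:
  fixes C :: "'a :: {field, finite} vec set"
  assumes MWS: "MWS_code n (Suc r) C"
  shows "\<Sum>{0..<max_weights CARD('a) (Suc r)} \<le> n * max_weights CARD('a) r"
proof -
  have C: "linear_code n (Suc r) C"
    and card: "card (weight_set C) = max_weights CARD('a) (Suc r)"
    using MWS by (auto simp: MWS_code_def)
  let ?m = "card (code_support n C)"
  have inj: "inj_on (\<lambda>w. ?m - w) (weight_set C)"
    using weight_set_le_support[OF linear_code_subset[OF C]]
    by (intro inj_onI) (metis diff_diff_cancel)
  have "\<Sum>{0..<max_weights CARD('a) (Suc r)} \<le> \<Sum>((\<lambda>w. ?m - w) ` weight_set C)"
    using card_sum_le_nat_sum[of "(\<lambda>w. ?m - w) ` weight_set C"]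
    by (simp add: card_image[OF inj] card)
  also have "\<dots> = ?m * max_weights CARD('a) r"
    using MWS_code_sum_deficits[OF MWS] by (simp add: sum.reindex[OF inj])
  finally show ?thesis
    using card_code_support_le[of n C] by (meson mult_le_mono1 order_trans)
qed

text \<open>
  The case of equality in \<open>MWS_code_length_bound\<close>: the word of weight \<open>n\<close> forces full support, and
  compactness makes the deficits consecutive from \<open>0\<close>.
\<close>

lemma strictly_compact_MWS_code_length:
  fixes C :: "'a :: {field, finite} vec set"
  assumes strict: "strictly_compact_MWS_code n (Suc r) C"
  shows "n * max_weights CARD('a) r = \<Sum>{0..<max_weights CARD('a) (Suc r)}"
proof -
  let ?Q = "max_weights CARD('a) (Suc r)" and ?d = "min_distance C"
  have MWS: "MWS_code n (Suc r) C" and S: "weight_set C = {?d ..< ?d + ?Q}"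
    and n: "n \<in> weight_set C"
    using strict by (auto simp: strictly_compact_MWS_code_def compact_MWS_code_def)
  have le: "w \<le> card (code_support n C)" if "w \<in> weight_set C" for w
    using MWS that weight_set_le_support[OF linear_code_subset] unfolding MWS_code_def by blast
  have m: "card (code_support n C) = n"
    using le[OF n] card_code_support_le[of n C] by simp
  \<comment> \<open>The largest weight of the interval cannot exceed the length, which is itself a weight.\<close>
  have last: "Suc n = ?d + ?Q"
  proof -
    have "?d + ?Q - 1 \<in> weight_set C"
      using n unfolding S by auto
    then have "?d + ?Q - 1 \<le> n"
      using le m by metis
    then show ?thesis
      using n unfolding S atLeastLessThan_iff by linarith
  qed
  have "bij_betw (\<lambda>w. n - w) (weight_set C) {0..<?Q}"
  proof (rule bij_betw_byWitness[where f' = "\<lambda>i. n - i"])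
    have bounds: "?d \<le> w \<and> w \<le> n" if "w \<in> weight_set C" for w
      using that last unfolding S atLeastLessThan_iff by linarith
    show "\<forall>w\<in>weight_set C. n - (n - w) = w"
      using bounds by simp
    have d: "?d \<le> n"
      using bounds[OF n] by simp
    then show "\<forall>i\<in>{0..<?Q}. n - (n - i) = i"
      using last by (intro ballI diff_diff_cancel) (unfold atLeastLessThan_iff, linarith)
    show "(\<lambda>w. n - w) ` weight_set C \<subseteq> {0..<?Q}"
    proof (rule image_subsetI)
      fix w
      assume "w \<in> weight_set C"
      then show "n - w \<in> {0..<?Q}"
        using bounds[of w] last unfolding atLeastLessThan_iff by linarith
    qed
    show "(\<lambda>i. n - i) ` {0..<?Q} \<subseteq> weight_set C"
      using last d unfolding S by (intro image_subsetI) (unfold atLeastLessThan_iff, linarith)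
  qed
  then have "(\<Sum>w\<in>weight_set C. n - w) = \<Sum>{0..<?Q}"
    by (rule sum.reindex_bij_betw)
  then show ?thesis
    using MWS_code_sum_deficits[OF MWS] by (simp add: m)
qed

theorem corollary13:
  fixes C :: "'a :: {field, finite} vec set" and n k :: nat
  assumes "k \<noteq> 1"
    and "strictly_compact_MWS_code n k C"
  shows "optimal_MWS_code n k C"
proof -
  have MWS: "MWS_code n k C"
    using assms(2) by (auto simp: strictly_compact_MWS_code_def compact_MWS_code_def)
  \<comment> \<open>The length is a weight, which rules out the zero code.\<close>
  have "max_weights CARD('a) k \<noteq> 0"
    using assms(2) by (auto simp: strictly_compact_MWS_code_def compact_MWS_code_def)
  then have "k \<noteq> 0"
    by (auto simp: max_weights_def intro: ccontr)
  with assms(1) obtain s where k: "k = Suc (Suc s)"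
    by (metis One_nat_def not0_implies_Suc)
  let ?R = "max_weights CARD('a) (Suc s)"
  have pos: "?R > 0"
    by (simp add: max_weights_Suc[OF card_field_ge_2])
  have "n \<le> n'" if "MWS_code n' k C'" for n' and C' :: "'a vec set"
  proof -
    have "n * ?R \<le> n' * ?R"
      using strictly_compact_MWS_code_length[of n "Suc s" C] assms(2)
        MWS_code_length_bound[of n' "Suc s" C'] that by (simp add: k)
    then show ?thesis
      using pos by simp
  qed
  then show ?thesis
    using MWS by (auto simp: optimal_MWS_code_def not_less[symmetric])
qed

end
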